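(* Let $d\ge 2$ and $3\le k\le d+1$. For $x_1,\ldots,x_k\in\mathbb S^{d-1}$ let $A(x_1,\ldots,x_k)$ denote the $(k-1)$-dimensional Euclidean volume of the simplex with vertices $x_1,\ldots,x_k$. Then the set of maximizers of $$I_{A^2}(\mu)=\int_{\mathbb S^{d-1}}\cdots\int_{\mathbb S^{d-1}} A^2(x_1,\ldots,x_k)\,d\mu(x_1)\cdots d\mu(x_k)$$ over $\mu\in\mathcal P(\mathbb S^{d-1})$ is exactly the set of balanced isotropic probability measures on $\mathbb S^{d-1}$. In particular, the normalized uniform surface measure $\sigma$ maximizes $I_{A^2}$. The value of the maximum is $\frac{k}{(k-1)!\,d^{k-1}}\binom{d}{k-1}$.
   Context: $\mathbb S^{d-1}$ is the unit sphere in $\mathbb R^d$, $\mathcal P(\mathbb S^{d-1})$ is the set of Borel probability measures on it, and $\sigma$ is the normalized surface measure. A measure $\mu$ is isotropic if $\int x x^T\,d\mu(x)=\frac1d I_d$ (equivalently $\int\langle x,y\rangle^2\,d\mu(x)=\frac1d$ for every unit vector $y$), and balanced if $\int x\,d\mu(x)=0$. *)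

theory Defs
  imports "HOL-Analysis.Analysis" "HOL-Probability.Probability"
begin

definition det_fun :: "nat \<Rightarrow> (nat \<Rightarrow> nat \<Rightarrow> real) \<Rightarrow> real" where
  "det_fun m G = (\<Sum>p | p permutes {..<m}. of_int (sign p) * (\<Prod>i<m. G i (p i)))"

text \<open>Squared (k-1)-dimensional volume of the simplex with vertices x 0, ..., x (k-1):
  Gram determinant of the edge vectors x i - x (k-1), divided by ((k-1)!)^2.\<close>
definition simplex_vol_sq :: "nat \<Rightarrow> (nat \<Rightarrow> 'a::euclidean_space) \<Rightarrow> real" where
  "simplex_vol_sq k x =
     det_fun (k - 1) (\<lambda>i j. (x i - x (k - 1)) \<bullet> (x j - x (k - 1))) / (fact (k - 1))\<^sup>2"

definition sphere_probs :: "'a::euclidean_space measure set" where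
  "sphere_probs = {\<mu>. prob_space \<mu> \<and> sets \<mu> = sets (restrict_space borel (sphere 0 1))}"

definition I_A2 :: "nat \<Rightarrow> 'a::euclidean_space measure \<Rightarrow> real" where
  "I_A2 k \<mu> = (\<integral>x. simplex_vol_sq k x \<partial>(PiM {..<k} (\<lambda>_. \<mu>)))"

definition balanced :: "'a::euclidean_space measure \<Rightarrow> bool" where
  "balanced \<mu> \<longleftrightarrow> (\<integral>x. x \<partial>\<mu>) = 0"

definition isotropic :: "'a::euclidean_space measure \<Rightarrow> bool" where
  "isotropic \<mu> \<longleftrightarrow> (\<forall>i\<in>Basis. \<forall>j\<in>Basis.
      (\<integral>x. (x \<bullet> i) * (x \<bullet> j) \<partial>\<mu>) = (if i = j then 1 / real DIM('a) else 0))"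

text \<open>Normalized surface measure on the sphere, as the cone measure: the push-forward of the
  normalized Lebesgue measure on the punctured unit ball under radial projection.\<close>
definition sphere_sigma :: "'a::euclidean_space measure" where
  "sphere_sigma = distr (uniform_measure lborel (ball 0 1 - {0}))
                        (restrict_space borel (sphere 0 1)) (\<lambda>x. x /\<^sub>R norm x)"

end

theory Submission
  imports Defs "Jordan_Normal_Form.Determinant"
begin

text \<open>Let \<open>m = k - 1\<close>, let \<open>c\<close> be the mean of \<open>\<mu>\<close>, and choose an orthonormal basis \<open>B\<close> that diagonalises the
  covariance form, with eigenvalues \<open>l b \<ge> 0\<close>. By Cauchy-Binet, \<open>m!\<close> times the Gram determinant of the edges is a
  sum, over sequences \<open>f\<close> of basis vectors, of squared minors; each minor is a bordered determinant whose columns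
  are the functions \<open>x \<mapsto> (x - c) \<bullet> f j\<close> and \<open>1\<close> evaluated at the \<open>m + 1\<close> vertices. For injective \<open>f\<close> these functions
  are orthogonal in \<open>L\<^sup>2(\<mu>)\<close>, so the expected square is \<open>(m + 1)!\<close> times the product of the \<open>l (f j)\<close>. Hence the
  functional is a constant times the elementary symmetric polynomial of degree \<open>m\<close> of the eigenvalues, whose sum
  is \<open>1 - |c|\<^sup>2\<close>. Maclaurin's inequality gives the bound, with equality exactly when \<open>c = 0\<close> and all
  eigenvalues are \<open>1/d\<close>. The surface measure is balanced and isotropic because it is invariant under signed
  permutations of the coordinates.\<close>

no_notation Matrix.scalar_prod (infix "\<bullet>" 70)

section \<open>Determinants\<close>

text \<open>Makes the transpose, product and block-matrix laws of \<open>Determinant.det\<close>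
  available.\<close>

lemma det_fun_eq_det: "det_fun m G = Determinant.det (Matrix.mat m m (\<lambda>(i, j). G i j))"
proof -
  have "i < m \<Longrightarrow> p permutes {..<m} \<Longrightarrow> p i < m" for i p
    using permutes_in_image[of p "{..<m}" i] by simp
  then show ?thesis
    by (auto simp: det_fun_def Determinant.det_def lessThan_atLeast0 intro!: sum.cong prod.cong)
qed

lemma det_fun_transpose: "det_fun m (\<lambda>i j. G j i) = det_fun m G"
proof -
  have "Matrix.mat m m (\<lambda>(i, j). G j i) = transpose_mat (Matrix.mat m m (\<lambda>(i, j). G i j))"
    by (rule eq_matI) auto
  then show ?thesis
    by (simp add: det_fun_eq_det Determinant.det_transpose[of _ m])
qed

lemma det_fun_identical_columns:
  assumes "a < m" "b < m" "a \<noteq> b" "\<And>i. i < m \<Longrightarrow> G i a = G i b"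
  shows "det_fun m G = 0"
  unfolding det_fun_eq_det
  by (rule det_identical_columns[of _ m a b]) (use assms in \<open>auto intro!: eq_vecI\<close>)

text \<open>Subtracting the last row from all others clears the border column.\<close>
lemma det_fun_bordered:
  "det_fun (Suc m) (\<lambda>i j. if j < m then a i j else 1) = det_fun m (\<lambda>i j. a i j - a m j)"
proof -
  let ?A = "Matrix.mat (Suc m) (Suc m) (\<lambda>(i, j). if j < m then a i j else 1)"
  \<comment> \<open>Left multiplication by \<open>?U\<close> adds the last row of \<open>?C\<close>
    to every other row, undoing the subtraction.\<close>
  let ?U = "Matrix.mat (Suc m) (Suc m) (\<lambda>(i, j). if i = j \<or> j = m then 1 else (0::real))"
  let ?C = "Matrix.mat (Suc m) (Suc m) (\<lambda>(i, j).
              if i < m then (if j < m then a i j - a m j else 0) else (if j < m then a m j else 1))"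
  have "?A = ?U * ?C"
  proof (rule eq_matI)
    fix i j assume "i < dim_row (?U * ?C)" "j < dim_col (?U * ?C)"
    then have ij: "i < Suc m" "j < Suc m" by auto
    have "(?U * ?C) $$ (i, j) = (\<Sum>l<Suc m. ?U $$ (i, l) * ?C $$ (l, j))"
      using ij by (simp add: scalar_prod_def lessThan_atLeast0 del: sum.lessThan_Suc)
    also have "\<dots> = (\<Sum>l<m. ?U $$ (i, l) * ?C $$ (l, j)) + ?C $$ (m, j)"
      using ij by simp
    also have "(\<Sum>l<m. ?U $$ (i, l) * ?C $$ (l, j)) = (\<Sum>l<m. if i = l then ?C $$ (l, j) else 0)"
      using ij by (intro sum.cong) auto
    also have "\<dots> + ?C $$ (m, j) = ?A $$ (i, j)"
      using ij by (auto simp: less_Suc_eq)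
    finally show "?A $$ (i, j) = (?U * ?C) $$ (i, j)" ..
  qed auto
  moreover have "Determinant.det (?U * ?C) = Determinant.det ?U * Determinant.det ?C"
    by (rule Determinant.det_mult) auto
  moreover have "Determinant.det ?U = 1"
  proof -
    have "upper_triangular ?U" by (auto simp: upper_triangular_def)
    then have "Determinant.det ?U = prod_list (diag_mat ?U)"
      by (rule Determinant.det_upper_triangular) auto
    also have "diag_mat ?U = map (\<lambda>_. 1) [0..<Suc m]"
      by (auto simp: diag_mat_def simp del: upt_Suc)
    finally show ?thesis by (simp add: prod_list_replicate map_replicate_const del: upt_Suc)
  qed
  moreover have "Determinant.det ?C = det_fun m (\<lambda>i j. a i j - a m j)"
  proof -
    have "?C = four_block_mat (Matrix.mat m m (\<lambda>(i, j). a i j - a m j)) (0\<^sub>m m 1)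
                 (Matrix.mat 1 m (\<lambda>(i, j). a m j)) (1\<^sub>m 1)"
      by (rule eq_matI) auto
    also have "Determinant.det \<dots> = det_fun m (\<lambda>i j. a i j - a m j) * Determinant.det (1\<^sub>m 1)"
      unfolding det_fun_eq_det
      by (rule det_four_block_mat_upper_right_zero[of _ m _ 1]) auto
    finally show ?thesis by simp
  qed
  ultimately show ?thesis by (simp add: det_fun_eq_det)
qed

lemma det_fun_permute_columns:
  assumes "q permutes {..<m}"
  shows "det_fun m (\<lambda>i j. G i (q j)) = of_int (sign q) * det_fun m G"
proof -
  have "det_fun m (\<lambda>i j. G i (q j))
      = (\<Sum>p | p permutes {..<m}. of_int (sign p) * (\<Prod>i<m. G i ((q \<circ> p) i)))"
    by (simp add: det_fun_def)
  also have "\<dots> = (\<Sum>p | p permutes {..<m}. of_int (sign (Hilbert_Choice.inv q \<circ> p)) * (\<Prod>i<m. G i (p i)))"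
    by (rule sum.reindex_bij_witness[of _ "\<lambda>p. Hilbert_Choice.inv q \<circ> p" "\<lambda>p. q \<circ> p"])
       (use assms in \<open>auto simp: permutes_inv_o o_assoc permutes_compose permutes_inv
          permutes_inverses fun_eq_iff\<close>)
  also have "\<dots> = (\<Sum>p | p permutes {..<m}. of_int (sign q) * (of_int (sign p) * (\<Prod>i<m. G i (p i))))"
  proof (rule sum.cong)
    fix p assume "p \<in> {p. p permutes {..<m}}"
    then have "permutation p" "permutation q" using assms permutation_permutes by blast+
    then show "of_int (sign (Hilbert_Choice.inv q \<circ> p)) * (\<Prod>i<m. G i (p i))
        = of_int (sign q) * (of_int (sign p) * (\<Prod>i<m. G i (p i)))"
      by (simp add: sign_compose sign_inverse permutation_inverse)
  qed simp
  finally show ?thesis by (simp add: det_fun_def sum_distrib_left)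
qed

text \<open>The Cauchy-Binet formula. A sum over all of \<open>{..<m} \<rightarrow>\<^sub>E B\<close> instead of over the subsets
  of \<open>B\<close> counts every minor \<open>m!\<close> times.\<close>
lemma det_fun_Gram:
  fixes u :: "nat \<Rightarrow> 'b \<Rightarrow> real"
  assumes "finite B"
  shows "fact m * det_fun m (\<lambda>i j. \<Sum>b\<in>B. u i b * u j b)
       = (\<Sum>f \<in> {f \<in> {..<m} \<rightarrow>\<^sub>E B. inj_on f {..<m}}. (det_fun m (\<lambda>i j. u i (f j)))\<^sup>2)"
proof -
  define D where "D f = det_fun m (\<lambda>i j. u i (f j))" for f
  define F where "F = ({..<m} \<rightarrow>\<^sub>E B)"
  define P where "P = {p. p permutes {..<m}}"
  have finP: "card P = fact m" by (simp add: P_def card_permutations)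
  \<comment> \<open>Expanding each product of sums chooses one \<open>f i\<close> in
    \<open>B\<close> for every row \<open>i\<close>.\<close>
  have "det_fun m (\<lambda>i j. \<Sum>b\<in>B. u i b * u j b)
      = (\<Sum>p\<in>P. of_int (sign p) * (\<Sum>f\<in>F. \<Prod>i<m. u i (f i) * u (p i) (f i)))"
    using assms by (simp add: det_fun_def P_def F_def prod_sum_PiE)
  also have "\<dots> = (\<Sum>f\<in>F. (\<Prod>i<m. u i (f i)) * (\<Sum>p\<in>P. of_int (sign p) * (\<Prod>i<m. u (p i) (f i))))"
    by (simp add: sum_distrib_left prod.distrib sum.swap[of _ F] mult_ac)
  also have "\<dots> = (\<Sum>f\<in>F. (\<Prod>i<m. u i (f i)) * D f)"
    by (subst D_def, subst det_fun_transpose[symmetric]) (simp add: det_fun_def P_def)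
  finally have gram: "det_fun m (\<lambda>i j. \<Sum>b\<in>B. u i b * u j b) = (\<Sum>f\<in>F. (\<Prod>i<m. u i (f i)) * D f)" .
  \<comment> \<open>Replacing \<open>f\<close> by \<open>f \<circ> q\<close> permutes the columns of
    the minor, so \<open>D\<close> picks up the sign of \<open>q\<close>.\<close>
  have perm: "(\<Sum>f\<in>F. (\<Prod>i<m. u i (f i)) * D f)
      = (\<Sum>f\<in>F. of_int (sign q) * (\<Prod>i<m. u i (f (q i))) * D f)" if "q \<in> P" for q
  proof -
    have q: "q permutes {..<m}" using that by (simp add: P_def)
    have in_F: "f \<circ> r \<in> F" if "f \<in> F" "r permutes {..<m}" for f r
      using that permutes_in_image[OF that(2)] permutes_not_in[OF that(2)]
      unfolding F_def by (auto simp: PiE_iff extensional_def)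
    have "(\<Sum>f\<in>F. (\<Prod>i<m. u i (f i)) * D f)
        = (\<Sum>f\<in>F. (\<Prod>i<m. u i ((f \<circ> q) i)) * D (f \<circ> q))"
      by (rule sum.reindex_bij_witness[of _ "\<lambda>f. f \<circ> q" "\<lambda>f. f \<circ> Hilbert_Choice.inv q"])
         (use q in \<open>auto simp: in_F permutes_inv comp_assoc permutes_inv_o\<close>)
    also have "\<dots> = (\<Sum>f\<in>F. of_int (sign q) * (\<Prod>i<m. u i (f (q i))) * D f)"
      using det_fun_permute_columns[OF q, of "\<lambda>i j. u i (_ j)"]
      by (simp add: D_def mult_ac)
    finally show ?thesis .
  qed
  \<comment> \<open>Summing the \<open>m!\<close> versions given by \<open>perm\<close> turns the
    single product into a second copy of the determinant.\<close>
  have "fact m * det_fun m (\<lambda>i j. \<Sum>b\<in>B. u i b * u j b) = (\<Sum>q\<in>P. \<Sum>f\<in>F. (\<Prod>i<m. u i (f i)) * D f)"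
    by (simp add: gram finP)
  also have "\<dots> = (\<Sum>q\<in>P. \<Sum>f\<in>F. of_int (sign q) * (\<Prod>i<m. u i (f (q i))) * D f)"
    by (intro sum.cong refl perm)
  also have "\<dots> = (\<Sum>f\<in>F. (\<Sum>q\<in>P. of_int (sign q) * (\<Prod>i<m. u i (f (q i)))) * D f)"
    by (subst sum.swap) (simp add: sum_distrib_right)
  also have "\<dots> = (\<Sum>f\<in>F. (D f)\<^sup>2)"
    by (simp add: D_def det_fun_def P_def power2_eq_square)
  \<comment> \<open>A repeated value of \<open>f\<close> produces two equal columns.\<close>
  also have "\<dots> = (\<Sum>f \<in> {f \<in> F. inj_on f {..<m}}. (D f)\<^sup>2)"
  proof (rule sum.mono_neutral_right)
    show "finite F" using assms by (auto simp: F_def intro!: finite_PiE)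
    show "\<forall>f\<in>F - {f \<in> F. inj_on f {..<m}}. (D f)\<^sup>2 = 0"
      unfolding D_def inj_on_def by (auto intro: det_fun_identical_columns)
  qed auto
  finally show ?thesis by (simp add: D_def F_def)
qed

section \<open>Maclaurin's inequality\<close>

text \<open>Multiplying the tangent line of degree \<open>m\<close> by \<open>s - t\<close> gives a concave parabola, which lies
  below its own tangent at \<open>a\<close>; this is the induction step.\<close>
lemma tangent_line_bound:
  fixes a s t :: real
  assumes "0 < m" "0 < a" "real (Suc m) * a \<le> s" "0 \<le> t" "t \<le> s"
  shows "t * (s - t) ^ m \<le> a * (s - a) ^ m + (s - a) ^ (m - 1) * (s - real (Suc m) * a) * (t - a)"
    and "t \<noteq> a \<Longrightarrow>
      t * (s - t) ^ m < a * (s - a) ^ m + (s - a) ^ (m - 1) * (s - real (Suc m) * a) * (t - a)"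
proof -
  \<comment> \<open>\<open>?L m\<close> is the tangent at \<open>a\<close> to
    \<open>t * (s - t) ^ m\<close>; its slope is nonnegative because \<open>a\<close> lies at or
    before the peak \<open>s / (m + 1)\<close>.\<close>
  let ?L = "\<lambda>m. a * (s - a) ^ m + (s - a) ^ (m - 1) * (s - real (Suc m) * a) * (t - a)"
  have strict: "t * (s - t) ^ m < ?L m" if "0 < m" "t \<noteq> a" "real (Suc m) * a \<le> s" for m
    using that(1,3)
  proof (induction m rule: nat_induct_non_zero)
    case 1
    have "?L 1 - t * (s - t) ^ 1 = (t - a)\<^sup>2" by (simp add: power2_eq_square algebra_simps)
    moreover have "(t - a)\<^sup>2 > 0" using that(2) by simp
    ultimately show ?case by linarith
  next
    case (Suc m)
    \<comment> \<open>The assumption for exponent \<open>Suc m\<close> puts \<open>a\<close>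
      strictly before the peak for exponent \<open>m\<close>, so the coefficient in
      \<open>key\<close> is positive.\<close>
    have le: "real (Suc m) * a + a \<le> s" using Suc.prems by (simp add: algebra_simps)
    have sa: "s - a > 0" "s - real (Suc m) * a > 0"
      using le assms(2) by (auto simp: algebra_simps) (smt (verit) mult_nonneg_nonneg of_nat_0_le_iff)
    have IH: "t * (s - t) ^ m < ?L m" using le assms(2) by (intro Suc.IH) linarith
    obtain n where n: "m = Suc n" using Suc.hyps by (cases m) auto
    have key: "?L (Suc m) - ?L m * (s - t) = (s - a) ^ (m - 1) * (s - real (Suc m) * a) * (t - a)\<^sup>2"
      by (simp add: n power2_eq_square algebra_simps)
    have pos: "(s - a) ^ (m - 1) * (s - real (Suc m) * a) * (t - a)\<^sup>2 > 0"
      using sa that(2) by simp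
    have "t * (s - t) ^ m * (s - t) \<le> ?L m * (s - t)"
      using IH assms(5) by (intro mult_right_mono) auto
    then show ?case using key pos by (simp add: mult_ac)
  qed
  show "t \<noteq> a \<Longrightarrow> t * (s - t) ^ m < ?L m" using strict assms by blast
  then show "t * (s - t) ^ m \<le> ?L m"
    by (cases "t = a") auto
qed

text \<open>For finite \<open>B\<close> this is \<open>m!\<close> times the elementary symmetric
  polynomial of degree \<open>m\<close>. Ordered sequences match the Cauchy-Binet sum and give a
  recursion that removes one element at a time.\<close>

definition inj_prod_sum :: "nat \<Rightarrow> 'b set \<Rightarrow> ('b \<Rightarrow> real) \<Rightarrow> real" where
  "inj_prod_sum m B l = (\<Sum>f \<in> {f \<in> {..<m} \<rightarrow>\<^sub>E B. inj_on f {..<m}}. \<Prod>i<m. l (f i))"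

lemma inj_prod_sum_0 [simp]: "inj_prod_sum 0 B l = 1"
  by (simp add: inj_prod_sum_def)

text \<open>The value \<open>b\<close> at position \<open>m\<close> is arbitrary, and injectivity
  confines the other values to \<open>B - {b}\<close>.\<close>

lemma inj_prod_sum_Suc:
  assumes "finite B"
  shows "inj_prod_sum (Suc m) B l = (\<Sum>b\<in>B. l b * inj_prod_sum m (B - {b}) l)"
proof -
  let ?F = "\<lambda>b. {f \<in> {..<m} \<rightarrow>\<^sub>E (B - {b}). inj_on f {..<m}}"
  let ?X = "{(b, g). b \<in> B \<and> g \<in> {..<m} \<rightarrow>\<^sub>E (B - {b}) \<and> inj_on g {..<m}}"
  have X: "?X = (SIGMA b:B. ?F b)" by auto
  have "inj_prod_sum (Suc m) B l = (\<Sum>f\<in>(\<lambda>(b, g). g(m := b)) ` ?X. \<Prod>i<Suc m. l (f i))"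
    using extensional_funcset_extend_domain_inj_on_eq[of m "{..<m}" B]
    by (simp add: inj_prod_sum_def lessThan_Suc)
  also have "\<dots> = (\<Sum>(b, g)\<in>?X. \<Prod>i<Suc m. l ((g(m := b)) i))"
    using extensional_funcset_extend_domain_inj_onI[of m "{..<m}" B]
    by (subst sum.reindex) (auto simp: case_prod_unfold)
  also have "\<dots> = (\<Sum>(b, g)\<in>?X. l b * (\<Prod>i<m. l (g i)))"
    by (intro sum.cong refl) (auto simp: mult.commute)
  also have "\<dots> = (\<Sum>b\<in>B. \<Sum>g\<in>?F b. l b * (\<Prod>i<m. l (g i)))"
    unfolding X using assms
    by (subst sum.Sigma) (auto intro!: finite_subset[OF _ finite_PiE[of "{..<m}" "\<lambda>_. B - {_}"]])
  finally show ?thesis by (simp add: inj_prod_sum_def sum_distrib_left)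
qed

lemma inj_prod_sum_const:
  assumes "finite B" "m \<le> card B" "\<And>b. b \<in> B \<Longrightarrow> l b = a"
  shows "inj_prod_sum m B l = fact m * real (card B choose m) * a ^ m"
  using assms
proof (induction m arbitrary: B)
  case (Suc m)
  then obtain n where n: "card B = Suc n" by (cases "card B") auto
  have "inj_prod_sum (Suc m) B l = (\<Sum>b\<in>B. a * (fact m * real (n choose m) * a ^ m))"
    unfolding inj_prod_sum_Suc[OF Suc.prems(1)]
  proof (intro sum.cong refl)
    fix b assume "b \<in> B"
    then show "l b * inj_prod_sum m (B - {b}) l = a * (fact m * real (n choose m) * a ^ m)"
      using Suc.IH[of "B - {b}"] Suc.prems n by simp
  qed
  also have "\<dots> = fact m * a ^ Suc m * (real (Suc n) * real (n choose m))"
    by (simp add: n)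
  also have "real (Suc n) * real (n choose m) = real (Suc m) * real (Suc n choose Suc m)"
    using Suc_times_binomial[of m n] by (metis of_nat_mult)
  finally show ?case by (simp add: n algebra_simps)
qed simp

text \<open>Induct on \<open>m\<close> over all sets: removing \<open>b\<close> leaves the total
  \<open>s - l b\<close>, so the induction hypothesis bounds its term by a multiple of
  \<open>l b * (s - l b) ^ m\<close>. Bound this by its tangent at the mean; the linear terms cancel
  in the sum. Strictness comes from the tangent at any \<open>l b\<close> off the mean, and starts
  at degree 2 because degree 1 is an identity.\<close>

lemma Maclaurin_inequality:
  assumes "finite B" "m \<le> card B" "\<And>b. b \<in> B \<Longrightarrow> 0 \<le> l b"
  shows "inj_prod_sum m B l \<le> fact m * real (card B choose m) * (sum l B / card B) ^ m"
    and "2 \<le> m \<Longrightarrow> b \<in> B \<Longrightarrow> l b \<noteq> sum l B / card B \<Longrightarrow>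
      inj_prod_sum m B l < fact m * real (card B choose m) * (sum l B / card B) ^ m"
proof -
  have "inj_prod_sum m B l \<le> fact m * real (card B choose m) * (sum l B / card B) ^ m \<and>
    (2 \<le> m \<longrightarrow> (\<exists>b\<in>B. l b \<noteq> sum l B / card B) \<longrightarrow>
      inj_prod_sum m B l < fact m * real (card B choose m) * (sum l B / card B) ^ m)"
    using assms
  proof (induction m arbitrary: B)
    case (Suc m)
    then obtain n where n: "card B = Suc n" by (cases "card B") auto
    define s a where "s = sum l B" and "a = s / Suc n"
    have s: "s = Suc n * a" by (simp add: a_def)
    have le_s: "l b \<le> s" if "b \<in> B" for b
      unfolding s_def using Suc.prems that by (intro member_le_sum) auto
    \<comment> \<open>Degree 1 is the sum itself, and \<open>s = 0\<close> forces every
      \<open>l b\<close> to vanish; the last case has the positive mean and exponent that the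
      tangent bound requires.\<close>
    consider "m = 0" | "s = 0" | "0 < m" "s \<noteq> 0" by blast
    then show ?case
    proof cases
      case 1
      then show ?thesis using n by (simp add: inj_prod_sum_Suc[OF Suc.prems(1)])
    next
      case 2
      then have "\<forall>b\<in>B. l b = 0" using Suc.prems by (simp add: s_def sum_nonneg_eq_0_iff)
      then show ?thesis
        using inj_prod_sum_const[OF Suc.prems(1,2), of l 0] by simp
    next
      case 3
      have "s \<ge> 0" unfolding s_def using Suc.prems by (intro sum_nonneg) auto
      with 3 have "s > 0" by simp
      then have "a > 0" by (simp add: a_def)
      \<comment> \<open>Since \<open>s\<close> is \<open>Suc n * a\<close> and
        \<open>m \<le> n\<close>, the mean lies at or before the peak.\<close>
      have "real (Suc m) * a \<le> s" 
        unfolding s using n Suc.prems \<open>a > 0\<close> by (intro mult_right_mono) auto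
      \<comment> \<open>The constant of the induction hypothesis for the \<open>n\<close> elements
        of \<open>B - {b}\<close>.\<close>
      define C where "C = fact m * real (n choose m) / real n ^ m"
      have "C > 0" using n Suc.prems by (cases "m = 0") (auto simp: C_def)
      define L where "L b = a * (s - a) ^ m + (s - a) ^ (m - 1) * (s - real (Suc m) * a) * (l b - a)" for b
      have "(\<Sum>b\<in>B. l b - a) = 0"
        by (simp add: sum_subtractf s_def[symmetric] n s)
      then have "(\<Sum>b\<in>B. L b) = Suc n * (a * (s - a) ^ m)"
        by (simp add: L_def sum.distrib sum_distrib_left[symmetric] n)
      also have "s - a = n * a" by (simp add: s algebra_simps)
      finally have sumL: "(\<Sum>b\<in>B. L b) = Suc n * a ^ Suc m * real n ^ m"
        by (simp add: power_mult_distrib)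
      have "n ^ m > 0" using n Suc.prems by (cases m) auto
      then have "(\<Sum>b\<in>B. C * L b) = fact m * a ^ Suc m * (real (Suc n) * real (n choose m))"
        unfolding sum_distrib_left[symmetric] sumL by (simp add: C_def)
      also have "real (Suc n) * real (n choose m) = real (Suc m) * real (Suc n choose Suc m)"
        using Suc_times_binomial[of m n] by (metis of_nat_mult)
      finally have bound: "(\<Sum>b\<in>B. C * L b) = fact (Suc m) * real (card B choose Suc m) * (sum l B / card B) ^ Suc m"
        by (simp add: n a_def s_def[symmetric] mult_ac del: binomial_Suc_Suc of_nat_Suc)
      have step: "l b * inj_prod_sum m (B - {b}) l \<le> C * (l b * (s - l b) ^ m)" if b: "b \<in> B" for b
      proof -
        have "inj_prod_sum m (B - {b}) l
            \<le> fact m * real (card (B - {b}) choose m) * (sum l (B - {b}) / card (B - {b})) ^ m"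
          using Suc.IH[of "B - {b}"] Suc.prems b n by simp
        also have "\<dots> = C * (s - l b) ^ m"
          using b n Suc.prems by (simp add: C_def power_divide s_def sum_diff1)
        finally have "inj_prod_sum m (B - {b}) l \<le> C * (s - l b) ^ m" .
        from mult_left_mono[OF this, of "l b"] Suc.prems(3)[OF b] show ?thesis by (simp add: mult_ac)
      qed
      have tan: "l b * (s - l b) ^ m \<le> L b" if "b \<in> B" for b
        unfolding L_def using that Suc.prems le_s \<open>0 < m\<close> \<open>a > 0\<close> \<open>real (Suc m) * a \<le> s\<close>
        by (intro tangent_line_bound) auto
      have le: "l b * inj_prod_sum m (B - {b}) l \<le> C * L b" if "b \<in> B" for b
        using step[OF that] tan[OF that] \<open>C > 0\<close> by (meson order_trans mult_le_cancel_left_pos)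
      have less: "l b * inj_prod_sum m (B - {b}) l < C * L b"
        if "b \<in> B" "l b \<noteq> a" "2 \<le> Suc m" for b
      proof -
        have "l b * (s - l b) ^ m < L b"
          unfolding L_def using that Suc.prems le_s \<open>0 < m\<close> \<open>a > 0\<close> \<open>real (Suc m) * a \<le> s\<close>
          by (intro tangent_line_bound) auto
        then show ?thesis
          using step[OF that(1)] \<open>C > 0\<close> by (meson order_le_less_trans mult_less_cancel_left_pos)
      qed
      show ?thesis
        unfolding bound[symmetric] inj_prod_sum_Suc[OF Suc.prems(1)]
      proof (intro conjI impI)
        show "(\<Sum>b\<in>B. l b * inj_prod_sum m (B - {b}) l) \<le> (\<Sum>b\<in>B. C * L b)"
          by (intro sum_mono le)
        assume "2 \<le> Suc m" "\<exists>b\<in>B. l b \<noteq> sum l B / card B"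
        then show "(\<Sum>b\<in>B. l b * inj_prod_sum m (B - {b}) l) < (\<Sum>b\<in>B. C * L b)"
          using Suc.prems(1) le less n by (intro sum_strict_mono_ex1) (auto simp: a_def s_def)
      qed
    qed
  qed simp
  then show "inj_prod_sum m B l \<le> fact m * real (card B choose m) * (sum l B / card B) ^ m"
    and "2 \<le> m \<Longrightarrow> b \<in> B \<Longrightarrow> l b \<noteq> sum l B / card B \<Longrightarrow>
      inj_prod_sum m B l < fact m * real (card B choose m) * (sum l B / card B) ^ m"
    by blast+
qed

section \<open>Diagonalising a symmetric form\<close>

text \<open>A maximiser \<open>v\<close> of \<open>Q u u\<close> on the unit sphere of a subspace is \<open>Q\<close>-orthogonal to its
  orthogonal complement in that subspace: otherwise \<open>v + t w\<close> does better for small \<open>t\<close>.\<close>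
lemma diagonalising_orthonormal_basis_subspace:
  fixes Q :: "'a::euclidean_space \<Rightarrow> 'a \<Rightarrow> real"
  assumes "bounded_bilinear Q" and sym: "\<And>u v. Q u v = Q v u" and "subspace V"
  shows "\<exists>B. B \<subseteq> V \<and> pairwise Linear_Algebra.orthogonal B \<and> (\<forall>b\<in>B. norm b = 1) \<and> span B = V \<and> finite B
          \<and> (\<forall>b\<in>B. \<forall>b'\<in>B. b \<noteq> b' \<longrightarrow> Q b b' = 0)"
  using \<open>subspace V\<close>
proof (induction "dim V" arbitrary: V)
  case 0
  then have "V = {0}" using subspace_0 by (auto simp: dim_eq_0)
  then show ?case by (intro exI[of _ "{}"]) auto
next
  case (Suc n)
  interpret Q: bounded_bilinear Q by fact
  let ?S = "V \<inter> sphere 0 1"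
  have "\<exists>x\<in>V. x \<noteq> 0" using Suc.hyps(2) by (metis dim_eq_0 subsetI singletonI Zero_not_Suc)
  then obtain x where "x \<in> V" "x \<noteq> 0" by blast
  then have "x /\<^sub>R norm x \<in> ?S" using Suc.prems by (auto simp: subspace_scale)
  moreover have "compact ?S" using Suc.prems by (simp add: closed_subspace closed_Int_compact)
  moreover have "continuous_on ?S (\<lambda>u. Q u u)" by (intro Q.continuous_on continuous_on_id)
  ultimately obtain v where v: "v \<in> ?S" and max: "\<And>u. u \<in> ?S \<Longrightarrow> Q u u \<le> Q v v"
    using continuous_attains_sup[of ?S "\<lambda>u. Q u u"] by (metis empty_iff)
  have v1: "v \<in> V" "norm v = 1" using v by auto
  \<comment> \<open>Normalising \<open>u\<close> extends maximality from unit vectors to all of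
    \<open>V\<close>.\<close>
  have max': "Q u u \<le> Q v v * (norm u)\<^sup>2" if "u \<in> V" for u
  proof (cases "u = 0")
    case False
    then have "Q (u /\<^sub>R norm u) (u /\<^sub>R norm u) \<le> Q v v"
      using that Suc.prems by (intro max) (auto simp: subspace_scale)
    then show ?thesis using False by (simp add: Q.scaleR_left Q.scaleR_right field_simps power2_eq_square)
  qed (simp add: Q.zero_left)
  have zero: "Q v w = 0" if w: "w \<in> V" "v \<bullet> w = 0" for w
  proof (rule ccontr)
    assume nz: "Q v w \<noteq> 0"
    have ineq: "2 * t * Q v w \<le> t\<^sup>2 * K" if "K = Q v v * (norm w)\<^sup>2 - Q w w" for t K
    proof -
      have "Q (v + t *\<^sub>R w) (v + t *\<^sub>R w) \<le> Q v v * (norm (v + t *\<^sub>R w))\<^sup>2"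
        using v1 w Suc.prems by (intro max') (auto simp: subspace_add subspace_scale)
      moreover have "(norm (v + t *\<^sub>R w))\<^sup>2 = 1 + t\<^sup>2 * (norm w)\<^sup>2"
        unfolding power2_norm_eq_inner using v1 w
        by (simp add: inner_add_left inner_add_right inner_commute power2_eq_square norm_eq_1)
      moreover have "Q (v + t *\<^sub>R w) (v + t *\<^sub>R w) = Q v v + 2 * t * Q v w + t\<^sup>2 * Q w w"
        using sym[of w v]
        by (simp add: Q.add_left Q.add_right Q.scaleR_left Q.scaleR_right power2_eq_square algebra_simps)
      ultimately have "Q v v + 2 * t * Q v w + t\<^sup>2 * Q w w \<le> Q v v * (1 + t\<^sup>2 * (norm w)\<^sup>2)"
        by simp
      then show ?thesis unfolding that by (simp add: algebra_simps)
    qed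
    \<comment> \<open>The \<open>+ 1\<close> keeps \<open>K\<close> positive, and this
      \<open>t\<close> reduces the inequality to
      \<open>2 * (Q v w)\<^sup>2 \<le> (Q v w)\<^sup>2\<close>.\<close>
    define K where "K = \<bar>Q v v * (norm w)\<^sup>2 - Q w w\<bar> + 1"
    define t where "t = Q v w / K"
    have "K > 0" by (simp add: K_def)
    have "2 * t * Q v w \<le> t\<^sup>2 * (Q v v * (norm w)\<^sup>2 - Q w w)" by (rule ineq) simp
    also have "\<dots> \<le> t\<^sup>2 * K" by (intro mult_left_mono) (auto simp: K_def)
    finally have "2 * (Q v w)\<^sup>2 \<le> (Q v w)\<^sup>2"
      using \<open>K > 0\<close> by (simp add: t_def power2_eq_square field_simps)
    then show False using nz by simp
  qed
  \<comment> \<open>The orthogonal complement of \<open>v\<close> in \<open>V\<close> has dimension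
    one less; by \<open>zero\<close>, adding \<open>v\<close> to a diagonalising basis of it keeps
    the form diagonal.\<close>
  define W where "W = {w \<in> V. Linear_Algebra.orthogonal v w}"
  have W: "subspace W" using Suc.prems
    by (auto simp: W_def subspace_def Linear_Algebra.orthogonal_def inner_add_right)
  have span: "span (insert v W) = V"
  proof (rule span_subspace)
    show "insert v W \<subseteq> V" using v1 by (auto simp: W_def)
    show "V \<subseteq> span (insert v W)"
    proof
      fix x assume "x \<in> V"
      then have "x - (v \<bullet> x) *\<^sub>R v \<in> W"
        using v1 Suc.prems
        by (auto simp: W_def Linear_Algebra.orthogonal_def inner_diff_right subspace_diff subspace_scale norm_eq_1)
      then show "x \<in> span (insert v W)" by (auto simp: span_insert intro: span_base)
    qed
  qed (rule Suc.prems)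
  have "v \<notin> W" using v1 by (auto simp: W_def Linear_Algebra.orthogonal_def)
  then have "v \<notin> span W" using W by (metis span_eq_iff)
  moreover have "dim V = dim (insert v W)" using span by (metis dim_span)
  ultimately have "dim V = Suc (dim W)" by (simp add: dim_insert)
  then obtain B where B: "B \<subseteq> W" "pairwise Linear_Algebra.orthogonal B" "\<forall>b\<in>B. norm b = 1" "span B = W" "finite B"
      "\<forall>b\<in>B. \<forall>b'\<in>B. b \<noteq> b' \<longrightarrow> Q b b' = 0"
    using Suc.hyps(1)[OF _ W] Suc.hyps(2) by auto
  have "span B = span W" using B(4) W by (metis span_eq_iff)
  then have "span (insert v B) = V" unfolding span[symmetric] span_insert by simp
  moreover have "Q v b = 0" "Linear_Algebra.orthogonal v b" if "b \<in> B" for b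
    using that B(1) zero by (auto simp: W_def Linear_Algebra.orthogonal_def)
  ultimately show ?case using B v1 sym
    by (intro exI[of _ "insert v B"]) (auto simp: pairwise_insert orthogonal_commute W_def)
qed

lemma diagonalising_orthonormal_basis:
  fixes Q :: "'a::euclidean_space \<Rightarrow> 'a \<Rightarrow> real"
  assumes "bounded_bilinear Q" and "\<And>u v. Q u v = Q v u"
  obtains B where "finite B" "card B = DIM('a)"
    "\<And>u v. u \<bullet> v = (\<Sum>b\<in>B. (u \<bullet> b) * (v \<bullet> b))" "\<And>x. x = (\<Sum>b\<in>B. (x \<bullet> b) *\<^sub>R b)"
    "\<And>b b'. b \<in> B \<Longrightarrow> b' \<in> B \<Longrightarrow> b \<noteq> b' \<Longrightarrow> Q b b' = 0"
proof -
  obtain B where B: "pairwise Linear_Algebra.orthogonal B" "\<forall>b\<in>B. norm b = 1" "span B = (UNIV :: 'a set)" "finite B"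
      "\<forall>b\<in>B. \<forall>b'\<in>B. b \<noteq> b' \<longrightarrow> Q b b' = 0"
    using diagonalising_orthonormal_basis_subspace[OF assms subspace_UNIV] by auto
  have "independent B" using B by (intro pairwise_orthogonal_independent) auto
  then have card: "card B = DIM('a)"
    using B(3) by (metis dim_UNIV dim_eq_card_independent dim_span)
  have expand: "(\<Sum>b\<in>B. (x \<bullet> b) *\<^sub>R b) = x" for x
    using B by (intro orthonormal_basis_expand) auto
  have "u \<bullet> v = (\<Sum>b\<in>B. (u \<bullet> b) * (v \<bullet> b))" for u v
  proof -
    have "u \<bullet> v = u \<bullet> (\<Sum>b\<in>B. (v \<bullet> b) *\<^sub>R b)" by (simp add: expand)
    then show ?thesis by (simp add: inner_sum_right mult.commute)
  qed
  then show ?thesis using that[of B] B card expand by metis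
qed

section \<open>Expected squares of determinants\<close>

text \<open>Andreief's identity for an orthogonal family \<open>h\<close>: only the diagonal \<open>p = q\<close> of the double sum
  over permutations survives.\<close>
lemma integral_det_fun_orthogonal_sq:
  fixes h :: "nat \<Rightarrow> 'a \<Rightarrow> real"
  assumes "prob_space M"
    and int: "\<And>i j. i < n \<Longrightarrow> j < n \<Longrightarrow> integrable M (\<lambda>x. h i x * h j x)"
    and orth: "\<And>i j. i < n \<Longrightarrow> j < n \<Longrightarrow> i \<noteq> j \<Longrightarrow> (\<integral>x. h i x * h j x \<partial>M) = 0"
  shows "integrable (PiM {..<n} (\<lambda>_. M)) (\<lambda>x. (det_fun n (\<lambda>i j. h j (x i)))\<^sup>2)"
    and "(\<integral>x. (det_fun n (\<lambda>i j. h j (x i)))\<^sup>2 \<partial>PiM {..<n} (\<lambda>_. M))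
       = fact n * (\<Prod>j<n. \<integral>x. (h j x)\<^sup>2 \<partial>M)"
proof -
  interpret prob_space M by fact
  interpret product_sigma_finite "\<lambda>_::nat. M" by standard
  let ?M = "PiM {..<n} (\<lambda>_. M)"
  define P where "P = {p. p permutes {..<n}}"
  define T where "T p q x = of_int (sign p * sign q) * (\<Prod>i<n. h (p i) (x i) * h (q i) (x i))" for p q x
  have finP: "finite P" by (simp add: P_def finite_permutations)
  have lt: "p i < n" if "p \<in> P" "i < n" for p i
    using that permutes_in_image[of p "{..<n}" i] by (simp add: P_def)
  have expand: "(det_fun n (\<lambda>i j. h j (x i)))\<^sup>2 = (\<Sum>p\<in>P. \<Sum>q\<in>P. T p q x)" for x
    unfolding det_fun_def power2_eq_square sum_product T_def P_def prod.distrib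
    by (intro sum.cong refl) simp
  have intT: "integrable ?M (T p q)" if "p \<in> P" "q \<in> P" for p q
    unfolding T_def using that
    by (intro integrable_mult_right
        product_integrable_prod[of "{..<n}" "\<lambda>i y. h (p i) y * h (q i) y"]) (simp_all add: int lt)
  have valT: "(\<integral>x. T p q x \<partial>?M) = (if p = q then \<Prod>j<n. \<integral>x. (h j x)\<^sup>2 \<partial>M else 0)"
    if pq: "p \<in> P" "q \<in> P" for p q
  proof -
    have "(\<integral>x. (\<Prod>i<n. h (p i) (x i) * h (q i) (x i)) \<partial>?M) = (\<Prod>i<n. \<integral>x. h (p i) x * h (q i) x \<partial>M)"
      using pq by (intro product_integral_prod[of "{..<n}" "\<lambda>i y. h (p i) y * h (q i) y"]) (simp_all add: int lt)
    then have "(\<integral>x. T p q x \<partial>?M) = of_int (sign p * sign q) * (\<Prod>i<n. \<integral>x. h (p i) x * h (q i) x \<partial>M)"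
      by (simp add: T_def)
    also have "\<dots> = (if p = q then \<Prod>j<n. \<integral>x. (h j x)\<^sup>2 \<partial>M else 0)"
    proof (cases "p = q")
      case True
      \<comment> \<open>For \<open>p = q\<close> the signs cancel, and the permutation only reorders
        the factors.\<close>
      have "(\<Prod>i<n. \<integral>x. (h (p i) x)\<^sup>2 \<partial>M) = (\<Prod>j<n. \<integral>x. (h j x)\<^sup>2 \<partial>M)"
        using pq permutes_imp_bij[of p "{..<n}"] unfolding P_def
        by (intro prod.reindex_bij_betw[of p "{..<n}" "{..<n}" "\<lambda>j. \<integral>x. (h j x)\<^sup>2 \<partial>M"]) auto
      then show ?thesis using True by (simp add: sign_idempotent power2_eq_square flip: of_int_mult)
    next
      case False
      \<comment> \<open>Orthogonality makes the factor at \<open>i\<close> vanish; both permutations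
        fix everything outside \<open>{..<n}\<close>, so \<open>i\<close> lies inside.\<close>
      then obtain i where i: "p i \<noteq> q i" by blast
      have "i < n"
      proof (rule ccontr)
        assume "\<not> i < n"
        then have "p i = i" "q i = i"
          using pq by (auto simp: P_def intro: permutes_not_in)
        with i show False by simp
      qed
      then have "(\<Prod>i<n. \<integral>x. h (p i) x * h (q i) x \<partial>M) = 0"
        using orth[OF lt lt] pq i by (intro prod_zero bexI[of _ i]) auto
      then show ?thesis using False by simp
    qed
    finally show ?thesis .
  qed
  show "integrable ?M (\<lambda>x. (det_fun n (\<lambda>i j. h j (x i)))\<^sup>2)"
    unfolding expand by (intro Bochner_Integration.integrable_sum intT)
  have "(\<integral>x. (det_fun n (\<lambda>i j. h j (x i)))\<^sup>2 \<partial>?M) = (\<Sum>p\<in>P. \<Sum>q\<in>P. \<integral>x. T p q x \<partial>?M)"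
    unfolding expand by (simp add: Bochner_Integration.integral_sum intT Bochner_Integration.integrable_sum)
  also have "\<dots> = (\<Sum>p\<in>P. \<Sum>q\<in>P. if p = q then \<Prod>j<n. \<integral>x. (h j x)\<^sup>2 \<partial>M else 0)"
    by (intro sum.cong refl valT)
  also have "\<dots> = real (card P) * (\<Prod>j<n. \<integral>x. (h j x)\<^sup>2 \<partial>M)"
    using finP by simp
  finally show "(\<integral>x. (det_fun n (\<lambda>i j. h j (x i)))\<^sup>2 \<partial>?M) = fact n * (\<Prod>j<n. \<integral>x. (h j x)\<^sup>2 \<partial>M)"
    by (simp add: P_def card_permutations)
qed

section \<open>Measures on the sphere\<close>

lemma sphere_probsD:
  assumes "\<mu> \<in> (sphere_probs :: 'a::euclidean_space measure set)"
  shows "prob_space \<mu>" "space \<mu> = sphere 0 1" "\<And>f. f \<in> borel_measurable borel \<Longrightarrow> f \<in> borel_measurable \<mu>"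
proof -
  have sets: "sets \<mu> = sets (restrict_space borel (sphere 0 1))"
    using assms by (simp add: sphere_probs_def)
  show "prob_space \<mu>" using assms by (simp add: sphere_probs_def)
  show "space \<mu> = sphere 0 1"
    using sets_eq_imp_space_eq[OF sets] by (simp add: space_restrict_space)
  show "f \<in> borel_measurable \<mu>" if "f \<in> borel_measurable borel" for f :: "'a \<Rightarrow> 'c::topological_space"
    using measurable_restrict_space1[OF that] measurable_cong_sets[OF sets refl] by blast
qed

text \<open>Compactness of the sphere bounds \<open>f\<close>, so later integrability claims reduce
  to continuity.\<close>

lemma sphere_probs_integrable:
  fixes f :: "'a::euclidean_space \<Rightarrow> 'b::{banach, second_countable_topology}"
  assumes "\<mu> \<in> sphere_probs" and cont: "continuous_on UNIV f"
  shows "integrable \<mu> f"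
proof -
  interpret prob_space \<mu> using assms(1) by (rule sphere_probsD)
  have "compact (f ` sphere 0 1)"
    by (intro compact_continuous_image continuous_on_subset[OF cont]) auto
  then obtain K where "\<forall>x\<in>sphere 0 1. norm (f x) \<le> K"
    using compact_imp_bounded bounded_iff by (metis imageI)
  then show ?thesis
    using sphere_probsD(2,3)[OF assms(1)] borel_measurable_continuous_onI[OF cont]
    by (intro integrable_const_bound[of _ K]) auto
qed

lemma sum_integral_inner_Basis_sq:
  assumes "\<mu> \<in> (sphere_probs :: 'a::euclidean_space measure set)"
  shows "(\<Sum>i\<in>Basis. \<integral>x. (x \<bullet> i)\<^sup>2 \<partial>\<mu>) = 1"
proof -
  interpret prob_space \<mu> using assms by (rule sphere_probsD)
  have "(\<Sum>i\<in>Basis. \<integral>x. (x \<bullet> i)\<^sup>2 \<partial>\<mu>) = (\<integral>x. (\<Sum>i\<in>Basis. (x \<bullet> i)\<^sup>2) \<partial>\<mu>)"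
    using assms by (intro Bochner_Integration.integral_sum[symmetric] sphere_probs_integrable)
      (auto intro!: continuous_intros)
  also have "\<dots> = (\<integral>x. 1 \<partial>\<mu>)"
  proof (intro Bochner_Integration.integral_cong refl)
    fix x assume "x \<in> space \<mu>"
    then have "norm x = 1" using sphere_probsD(2)[OF assms] by simp
    then show "(\<Sum>i\<in>Basis. (x \<bullet> i)\<^sup>2) = 1"
      using euclidean_inner[of x x] by (simp add: power2_eq_square norm_eq_1)
  qed
  finally show ?thesis by (simp add: prob_space)
qed

section \<open>Surface measure and its coordinate symmetries\<close>

lemma punctured_ball_emeasure:
  "emeasure lborel (ball 0 1 - {0 :: 'a::euclidean_space}) \<noteq> 0"
  "emeasure lborel (ball 0 1 - {0 :: 'a}) \<noteq> \<infinity>"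
proof -
  have eq: "emeasure lborel (ball 0 1 - {0 :: 'a}) = emeasure lborel (ball 0 1 :: 'a set)"
    by (intro emeasure_Diff_null_set) (auto simp: null_sets_def)
  show "emeasure lborel (ball 0 1 - {0 :: 'a}) \<noteq> 0"
    unfolding eq using open_not_negligible[of "ball 0 1 :: 'a set"]
    by (auto simp: negligible_iff_null_sets null_sets_completionI null_sets_def)
  show "emeasure lborel (ball 0 1 - {0 :: 'a}) \<noteq> \<infinity>"
    unfolding eq using emeasure_lborel_ball_finite[of "0::'a" 1] by simp
qed


text \<open>Every coordinate is scaled by a factor of absolute value 1, so the Jacobian factor is
  1.\<close>

lemma lborel_distr_flip:
  fixes i :: "'a::euclidean_space"
  defines "T \<equiv> (\<lambda>x::'a. \<Sum>j\<in>Basis. ((if j = i then - 1 else 1) * (x \<bullet> j)) *\<^sub>R j)"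
  shows "distr lborel borel T = lborel"
proof -
  have "lborel = density (distr lborel borel T) (\<lambda>_. ennreal (\<Prod>j\<in>Basis. \<bar>if j = i then - 1 else 1\<bar>))"
    unfolding T_def using lborel_affine_euclidean[of "\<lambda>j. if j = i then - 1 else 1" "0::'a"] by simp
  also have "(\<Prod>j\<in>(Basis::'a set). \<bar>if j = i then - 1 else (1::real)\<bar>) = 1"
    by (intro prod.neutral) auto
  finally show ?thesis by (simp add: density_1)
qed

text \<open>Boxes pull back to boxes with the same side lengths in another order, and box volumes
  determine Lebesgue measure.\<close>

lemma lborel_distr_permute:
  fixes p :: "'a::euclidean_space \<Rightarrow> 'a"
  assumes p: "p permutes Basis"
  defines "T \<equiv> (\<lambda>x::'a. \<Sum>j\<in>Basis. (x \<bullet> p j) *\<^sub>R j)"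
  shows "distr lborel borel T = lborel"
proof (rule lborel_eqI[symmetric])
  fix l u :: 'a assume le: "\<And>b. b \<in> Basis \<Longrightarrow> l \<bullet> b \<le> u \<bullet> b"
  let ?R = "\<lambda>x::'a. \<Sum>j\<in>Basis. (x \<bullet> Hilbert_Choice.inv p j) *\<^sub>R j"
  have pB: "p j \<in> Basis \<longleftrightarrow> j \<in> Basis" "Hilbert_Choice.inv p j \<in> Basis \<longleftrightarrow> j \<in> Basis" for j
    using permutes_in_image[OF p] permutes_in_image[OF permutes_inv[OF p]] by auto
  have T: "T x \<bullet> j = x \<bullet> p j" "?R x \<bullet> j = x \<bullet> Hilbert_Choice.inv p j" if "j \<in> Basis" for x j
    using that by (simp_all add: T_def)
  have "T -` box l u = box (?R l) (?R u)"
  proof (rule Set.set_eqI)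
    fix x
    have "x \<in> T -` box l u \<longleftrightarrow> (\<forall>j\<in>Basis. l \<bullet> j < x \<bullet> p j \<and> x \<bullet> p j < u \<bullet> j)"
      by (simp add: mem_box T)
    also have "\<dots> \<longleftrightarrow> (\<forall>j\<in>Basis. l \<bullet> Hilbert_Choice.inv p j < x \<bullet> j \<and> x \<bullet> j < u \<bullet> Hilbert_Choice.inv p j)"
      using pB permutes_inverses[OF p] by metis
    also have "\<dots> \<longleftrightarrow> x \<in> box (?R l) (?R u)"
      by (simp add: mem_box T)
    finally show "x \<in> T -` box l u \<longleftrightarrow> x \<in> box (?R l) (?R u)" .
  qed
  moreover have "T \<in> borel_measurable borel" unfolding T_def by measurable
  ultimately have "emeasure (distr lborel borel T) (box l u) = emeasure lborel (box (?R l) (?R u))"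
    by (simp add: emeasure_distr)
  also have "\<dots> = ennreal (\<Prod>b\<in>Basis. (?R u - ?R l) \<bullet> b)"
    using le pB by (intro emeasure_lborel_box) (simp add: T)
  also have "(\<Prod>b\<in>Basis. (?R u - ?R l) \<bullet> b) = (\<Prod>b\<in>Basis. (u - l) \<bullet> Hilbert_Choice.inv p b)"
    by (intro prod.cong refl) (simp add: T inner_diff_left)
  also have "\<dots> = (\<Prod>b\<in>Basis. (u - l) \<bullet> b)"
    using prod.permute[OF permutes_inv[OF p], of "\<lambda>b. (u - l) \<bullet> b"] by (simp add: o_def)
  finally show "emeasure (distr lborel borel T) (box l u) = ennreal (\<Prod>b\<in>Basis. (u - l) \<bullet> b)" .
qed simp

text \<open>The radial projection sends \<open>0\<close> to \<open>0\<close>, outside the sphere, so it is not a measurable map into the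
  sphere. Redefining it on the null set \<open>{0}\<close> makes the lemmas about \<open>distr\<close> applicable.\<close>
definition radial :: "'a::euclidean_space \<Rightarrow> 'a" where
  "radial x = (if x = 0 then SOME b. b \<in> Basis else x /\<^sub>R norm x)"

abbreviation punctured_ball_measure :: "'a::euclidean_space measure" where
  "punctured_ball_measure \<equiv> uniform_measure lborel (ball 0 1 - {0})"

lemma norm_radial [simp]: "norm (radial x) = 1"
  using someI_ex[of "\<lambda>b::'a. b \<in> Basis"] by (auto simp: radial_def)

lemma radial_measurable:
  "radial \<in> punctured_ball_measure \<rightarrow>\<^sub>M restrict_space borel (sphere 0 1)"
  by (intro measurable_restrict_space2) (auto simp: radial_def[abs_def])

lemma AE_punctured_ball_measure: "AE x in punctured_ball_measure. (x::'a::euclidean_space) \<noteq> 0"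
  by (intro AE_uniform_measureI) auto

text \<open>The two maps agree off the null set \<open>{0}\<close>, so preimages have equal measure.
  Unfolding \<open>distr\<close> allows this comparison although one of the maps leaves the sphere
  at the origin.\<close>

lemma sphere_sigma_eq_distr_radial:
  "sphere_sigma = distr punctured_ball_measure (restrict_space borel (sphere 0 1)) radial"
  unfolding sphere_sigma_def distr_def
proof (rule measure_of_eq)
  let ?N = "restrict_space borel (sphere (0::'a) 1)"
  show "sets ?N \<subseteq> Pow (space ?N)" by (rule sets.space_closed)
  fix A assume "A \<in> sigma_sets (space ?N) (sets ?N)"
  then have A: "A \<in> sets ?N" by (metis sets.sigma_sets_eq)
  \<comment> \<open>The sphere is closed, so its Borel subsets are Borel in the whole space.\<close>
  then have "A \<in> sets borel" by (auto simp: sets_restrict_space)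
  then have "(\<lambda>x. x /\<^sub>R norm x) -` A \<inter> space borel \<in> sets borel"
    by (intro measurable_sets[of _ borel borel]) auto
  moreover have "radial -` A \<inter> space punctured_ball_measure \<in> sets punctured_ball_measure"
    by (rule measurable_sets[OF radial_measurable A])
  moreover have "AE x in punctured_ball_measure.
      (x \<in> (\<lambda>x. x /\<^sub>R norm x) -` A \<inter> space punctured_ball_measure)
    = (x \<in> radial -` A \<inter> space punctured_ball_measure)"
    using AE_punctured_ball_measure by eventually_elim (simp add: radial_def)
  ultimately show "emeasure punctured_ball_measure ((\<lambda>x. x /\<^sub>R norm x) -` A \<inter> space punctured_ball_measure)
      = emeasure punctured_ball_measure (radial -` A \<inter> space punctured_ball_measure)"
    by (intro emeasure_eq_AE) auto
qed

lemma sphere_sigma_in_sphere_probs: "sphere_sigma \<in> sphere_probs"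
proof -
  have "prob_space punctured_ball_measure"
    using punctured_ball_emeasure by (intro prob_space_uniform_measure)
  then have "prob_space sphere_sigma"
    unfolding sphere_sigma_eq_distr_radial by (rule prob_space.prob_space_distr[OF _ radial_measurable])
  then show ?thesis by (simp add: sphere_probs_def sphere_sigma_def)
qed

text \<open>Such a \<open>T\<close> preserves the uniform measure on the punctured ball and, being
  linear and norm-preserving, commutes with radial projection off the origin.\<close>

lemma sphere_sigma_invariant:
  fixes T :: "'a::euclidean_space \<Rightarrow> 'a" and f :: "'a \<Rightarrow> real"
  assumes "linear T" and norm: "\<And>x. norm (T x) = norm x" and lborel: "distr lborel borel T = lborel"
    and cont: "continuous_on UNIV f"
  shows "(\<integral>x. f (T x) \<partial>sphere_sigma) = (\<integral>x. f x \<partial>sphere_sigma)"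
proof -
  let ?M = "punctured_ball_measure :: 'a measure"
  let ?N = "restrict_space borel (sphere (0::'a) 1)"
  let ?w = "\<lambda>x::'a. indicator (ball 0 1 - {0}) x / emeasure lborel (ball 0 1 - {0::'a})"
  have [measurable]: "f \<in> borel_measurable borel" using cont by (rule borel_measurable_continuous_onI)
  have [measurable]: "T \<in> borel_measurable borel"
    using \<open>linear T\<close> by (intro borel_measurable_continuous_onI linear_continuous_on linear_conv_bounded_linear[THEN iffD1])
  have [measurable]: "radial \<in> borel_measurable borel" unfolding radial_def[abs_def] by measurable
  have [measurable]: "?w \<in> borel_measurable borel"
    by (intro borel_measurable_divide_ennreal borel_measurable_indicator) auto
  have T0: "T x = 0 \<longleftrightarrow> x = 0" for x using norm[of x] by (metis norm_eq_zero)
  have restr: "g \<in> borel_measurable ?N" if "g \<in> borel_measurable borel" for g :: "'a \<Rightarrow> real"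
    using that by (rule measurable_restrict_space1)
  \<comment> \<open>\<open>T\<close> preserves norms, hence membership in the punctured
    ball.\<close>
  have w: "?w \<circ> T = ?w"
    by (auto simp: fun_eq_iff norm T0 dist_norm indicator_def)
  have "?M = density (distr lborel borel T) ?w"
    by (simp add: uniform_measure_def lborel)
  also have "\<dots> = distr (density lborel (?w \<circ> T)) borel T"
    by (subst density_distr) (auto simp: o_def)
  finally have M: "?M = distr ?M borel T"
    unfolding w by (simp add: uniform_measure_def)
  have "(\<integral>x. f x \<partial>sphere_sigma) = (\<integral>x. f (radial x) \<partial>?M)"
    unfolding sphere_sigma_eq_distr_radial by (intro integral_distr radial_measurable restr) measurable
  also have "\<dots> = (\<integral>x. f (radial (T x)) \<partial>?M)"
    by (subst M, subst integral_distr) auto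
  also have "\<dots> = (\<integral>x. f (T (radial x)) \<partial>?M)"
  proof (rule integral_cong_AE)
    show "AE x in ?M. f (radial (T x)) = f (T (radial x))"
      using AE_punctured_ball_measure
      by eventually_elim (simp add: radial_def T0 norm linear_cmul[OF \<open>linear T\<close>])
  qed auto
  also have "\<dots> = (\<integral>x. f (T x) \<partial>sphere_sigma)"
    unfolding sphere_sigma_eq_distr_radial
    by (intro integral_distr[symmetric] radial_measurable restr) measurable
  finally show ?thesis ..
qed

lemma sphere_sigma_flip:
  fixes f :: "'a::euclidean_space \<Rightarrow> real"
  assumes "continuous_on UNIV f"
  shows "(\<integral>x. f (\<Sum>j\<in>Basis. ((if j = i then - 1 else 1) * (x \<bullet> j)) *\<^sub>R j) \<partial>sphere_sigma) = (\<integral>x. f x \<partial>sphere_sigma)"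
proof (rule sphere_sigma_invariant[OF _ _ lborel_distr_flip assms])
  show "linear (\<lambda>x::'a. \<Sum>j\<in>Basis. ((if j = i then - 1 else 1) * (x \<bullet> j)) *\<^sub>R j)"
    by (intro linearI) (auto simp: inner_add_left algebra_simps sum.distrib scaleR_sum_right intro!: sum.cong)
  show "norm (\<Sum>j\<in>Basis. ((if j = i then - 1 else 1) * (x \<bullet> j)) *\<^sub>R j) = norm x" for x :: 'a
    unfolding norm_eq by (subst (1 2) euclidean_inner) (auto intro!: sum.cong)
qed

lemma sphere_sigma_permute:
  fixes f :: "'a::euclidean_space \<Rightarrow> real"
  assumes "continuous_on UNIV f" and p: "p permutes Basis"
  shows "(\<integral>x. f (\<Sum>j\<in>Basis. (x \<bullet> p j) *\<^sub>R j) \<partial>sphere_sigma) = (\<integral>x. f x \<partial>sphere_sigma)"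
proof (rule sphere_sigma_invariant[OF _ _ lborel_distr_permute[OF p] assms(1)])
  show "linear (\<lambda>x::'a. \<Sum>j\<in>Basis. (x \<bullet> p j) *\<^sub>R j)"
    by (intro linearI) (auto simp: inner_add_left algebra_simps sum.distrib scaleR_sum_right intro!: sum.cong)
  show "norm (\<Sum>j\<in>Basis. (x \<bullet> p j) *\<^sub>R j) = norm x" for x :: 'a
  proof -
    have "(\<Sum>j\<in>Basis. (x \<bullet> p j)\<^sup>2) = (\<Sum>j\<in>Basis. (x \<bullet> j)\<^sup>2)"
      using sum.permute[OF p, of "\<lambda>j. (x \<bullet> j)\<^sup>2"] by (simp add: o_def)
    then show ?thesis
      unfolding norm_eq by (subst (1 2) euclidean_inner) (simp add: power2_eq_square)
  qed
qed

text \<open>Reflecting coordinate \<open>i\<close> negates the \<open>i\<close>-th component of the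
  mean.\<close>

lemma balanced_sphere_sigma: "balanced (sphere_sigma :: 'a::euclidean_space measure)"
  unfolding balanced_def
proof (rule euclidean_eqI)
  fix i :: 'a assume i: "i \<in> Basis"
  have "integrable sphere_sigma (\<lambda>x::'a. x)"
    by (intro sphere_probs_integrable sphere_sigma_in_sphere_probs continuous_on_id)
  then have "(\<integral>x. x \<partial>sphere_sigma) \<bullet> i = (\<integral>x. x \<bullet> i \<partial>sphere_sigma)"
    by simp
  moreover have "(\<integral>x. x \<bullet> i \<partial>sphere_sigma) = (\<integral>x. - (x \<bullet> i) \<partial>sphere_sigma)"
    using sphere_sigma_flip[of "\<lambda>x. x \<bullet> i" i] i by (simp add: continuous_on_inner)
  moreover have "(\<integral>x. - (x \<bullet> i) \<partial>sphere_sigma) = - (\<integral>x. x \<bullet> i \<partial>sphere_sigma)"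
    by (rule Bochner_Integration.integral_minus)
  ultimately have "(\<integral>x. x \<partial>sphere_sigma) \<bullet> i = 0" by linarith
  then show "(\<integral>x. x \<partial>sphere_sigma) \<bullet> i = 0 \<bullet> i" by simp
qed

text \<open>Reflecting coordinate \<open>i\<close> negates the mixed moments. Transposing
  coordinates makes the pure second moments equal, and they sum to 1.\<close>

lemma isotropic_sphere_sigma: "isotropic (sphere_sigma :: 'a::euclidean_space measure)"
  unfolding isotropic_def
proof (intro ballI)
  fix i j :: 'a assume ij: "i \<in> Basis" "j \<in> Basis"
  let ?E = "\<lambda>i::'a. \<integral>x. (x \<bullet> i)\<^sup>2 \<partial>sphere_sigma"
  show "(\<integral>x. (x \<bullet> i) * (x \<bullet> j) \<partial>sphere_sigma) = (if i = j then 1 / real DIM('a) else 0)"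
  proof (cases "i = j")
    case False
    then have "(\<integral>x. (x \<bullet> i) * (x \<bullet> j) \<partial>sphere_sigma) = (\<integral>x. - ((x \<bullet> i) * (x \<bullet> j)) \<partial>sphere_sigma)"
      using sphere_sigma_flip[of "\<lambda>x. (x \<bullet> i) * (x \<bullet> j)" i] ij by (simp add: continuous_intros)
    then show ?thesis using False by simp
  next
    case True
    have eq: "?E b = ?E i" if b: "b \<in> Basis" for b :: 'a
    proof -
      have "Transposition.transpose i b permutes Basis" using ij b by (intro permutes_swap_id)
      from sphere_sigma_permute[of "\<lambda>x. (x \<bullet> i)\<^sup>2", OF _ this] ij show ?thesis
        by (simp add: continuous_intros)
    qed
    have "(\<Sum>b\<in>Basis. ?E b) = (\<Sum>b\<in>(Basis :: 'a set). ?E i)"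
      by (intro sum.cong refl eq)
    also have "\<dots> = real DIM('a) * ?E i" by simp
    finally have "real DIM('a) * ?E i = 1"
      using sum_integral_inner_Basis_sq[OF sphere_sigma_in_sphere_probs] by metis
    then show ?thesis
      using True by (simp add: field_simps power2_eq_square)
  qed
qed

section \<open>Volume and covariance\<close>

definition covariance_form :: "'a::euclidean_space measure \<Rightarrow> 'a \<Rightarrow> 'a \<Rightarrow> real" where
  "covariance_form \<mu> u v = (\<integral>x. ((x - (\<integral>y. y \<partial>\<mu>)) \<bullet> u) * ((x - (\<integral>y. y \<partial>\<mu>)) \<bullet> v) \<partial>\<mu>)"

lemma integral_inner_sphere_probs:
  assumes "\<mu> \<in> (sphere_probs :: 'a::euclidean_space measure set)"
  shows "(\<integral>x. x \<bullet> u \<partial>\<mu>) = (\<integral>x. x \<partial>\<mu>) \<bullet> u"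
  using sphere_probs_integrable[OF assms continuous_on_id] by simp

lemma integral_centred_inner:
  assumes "\<mu> \<in> (sphere_probs :: 'a::euclidean_space measure set)"
  shows "(\<integral>x. (x - (\<integral>y. y \<partial>\<mu>)) \<bullet> u \<partial>\<mu>) = 0"
proof -
  interpret prob_space \<mu> using assms by (rule sphere_probsD)
  have "integrable \<mu> (\<lambda>x. x \<bullet> u)"
    using assms by (intro sphere_probs_integrable continuous_intros)
  then show ?thesis
    by (simp add: inner_diff_left integral_inner_sphere_probs[OF assms] prob_space
        del: integral_inner_left)
qed

lemma covariance_form_eq:
  assumes "\<mu> \<in> (sphere_probs :: 'a::euclidean_space measure set)"
  shows "covariance_form \<mu> u v
    = (\<integral>x. (x \<bullet> u) * (x \<bullet> v) \<partial>\<mu>) - ((\<integral>x. x \<partial>\<mu>) \<bullet> u) * ((\<integral>x. x \<partial>\<mu>) \<bullet> v)"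
proof -
  interpret prob_space \<mu> using assms by (rule sphere_probsD)
  define c where "c = (\<integral>x. x \<partial>\<mu>)"
  have int: "integrable \<mu> (\<lambda>x. (x \<bullet> u) * (x \<bullet> v))" "integrable \<mu> (\<lambda>x. (c \<bullet> v) * (x \<bullet> u))"
    "integrable \<mu> (\<lambda>x. (c \<bullet> u) * ((x - c) \<bullet> v))"
    using assms by (intro sphere_probs_integrable continuous_intros; simp)+
  \<comment> \<open>This grouping keeps a centred factor in the last term, whose integral therefore
    vanishes.\<close>
  have "covariance_form \<mu> u v
      = (\<integral>x. (x \<bullet> u) * (x \<bullet> v) - (c \<bullet> v) * (x \<bullet> u) - (c \<bullet> u) * ((x - c) \<bullet> v) \<partial>\<mu>)"
    unfolding covariance_form_def c_def[symmetric]
    by (intro Bochner_Integration.integral_cong refl) (simp add: inner_diff_left algebra_simps)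
  also have "\<dots> = (\<integral>x. (x \<bullet> u) * (x \<bullet> v) \<partial>\<mu>) - (\<integral>x. (c \<bullet> v) * (x \<bullet> u) \<partial>\<mu>) - (\<integral>x. (c \<bullet> u) * ((x - c) \<bullet> v) \<partial>\<mu>)"
    using int by (simp only: Bochner_Integration.integral_diff Bochner_Integration.integrable_diff)
  also have "(\<integral>x. (c \<bullet> u) * ((x - c) \<bullet> v) \<partial>\<mu>) = 0"
    unfolding integral_mult_right_zero using integral_centred_inner[OF assms] by (simp add: c_def)
  also have "(\<integral>x. (c \<bullet> v) * (x \<bullet> u) \<partial>\<mu>) = (c \<bullet> v) * (c \<bullet> u)"
    unfolding integral_mult_right_zero by (simp only: integral_inner_sphere_probs[OF assms] c_def)
  finally show ?thesis by (simp add: c_def)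
qed

lemma bounded_bilinear_covariance_form:
  assumes "\<mu> \<in> (sphere_probs :: 'a::euclidean_space measure set)"
  shows "bounded_bilinear (covariance_form \<mu>)"
proof -
  have int: "integrable \<mu> (\<lambda>x. ((x - c) \<bullet> u) * ((x - c) \<bullet> v))" for c u v
    using assms by (intro sphere_probs_integrable continuous_intros)
  have right: "linear (covariance_form \<mu> u)" for u
    by (rule linearI) (simp_all add: covariance_form_def inner_add_right distrib_left int
        mult.left_commute[of _ "_ :: real"])
  have "covariance_form \<mu> u v = covariance_form \<mu> v u" for u v
    by (simp add: covariance_form_def mult.commute)
  then have "bilinear (covariance_form \<mu>)"
    using right unfolding bilinear_def by presburger
  then show ?thesis by (simp add: bilinear_conv_bounded_bilinear)
qed

text \<open>Parseval turns the second moments into the integral of \<open>(norm x)\<^sup>2\<close>,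
  which is 1 on the sphere. A nonzero mean thus lowers the trace.\<close>

lemma trace_covariance_form:
  assumes "\<mu> \<in> (sphere_probs :: 'a::euclidean_space measure set)"
    and inner: "\<And>u v :: 'a. u \<bullet> v = (\<Sum>b\<in>B. (u \<bullet> b) * (v \<bullet> b))"
  shows "(\<Sum>b\<in>B. covariance_form \<mu> b b) = 1 - (norm (\<integral>x. x \<partial>\<mu>))\<^sup>2"
proof -
  interpret prob_space \<mu> using assms by (intro sphere_probsD)
  have "(\<Sum>b\<in>B. \<integral>x. (x \<bullet> b) * (x \<bullet> b) \<partial>\<mu>) = (\<integral>x. (\<Sum>b\<in>B. (x \<bullet> b) * (x \<bullet> b)) \<partial>\<mu>)"
    using assms(1) by (intro Bochner_Integration.integral_sum[symmetric] sphere_probs_integrable continuous_intros)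
  also have "\<dots> = (\<integral>x. 1 \<partial>\<mu>)"
    unfolding inner[symmetric] using sphere_probsD(2)[OF assms(1)]
    by (intro Bochner_Integration.integral_cong refl) (simp add: norm_eq_1)
  finally have "(\<Sum>b\<in>B. \<integral>x. (x \<bullet> b) * (x \<bullet> b) \<partial>\<mu>) = 1" by (simp add: prob_space)
  then show ?thesis
    by (simp only: covariance_form_eq[OF assms(1)] sum_subtractf inner[symmetric] power2_norm_eq_inner)
qed

text \<open>Translation invariance of the volume lets the vertices be centred; the border column of ones is then
  orthogonal to the linear coordinates in \<open>L\<^sup>2(\<mu>)\<close>, and these are mutually orthogonal by the choice of \<open>B\<close>.\<close>
lemma I_A2_eq_inj_prod_sum:
  assumes \<mu>: "\<mu> \<in> (sphere_probs :: 'a::euclidean_space measure set)" and "finite B"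
    and inner: "\<And>u v :: 'a. u \<bullet> v = (\<Sum>b\<in>B. (u \<bullet> b) * (v \<bullet> b))"
    and diag: "\<And>b b'. b \<in> B \<Longrightarrow> b' \<in> B \<Longrightarrow> b \<noteq> b' \<Longrightarrow> covariance_form \<mu> b b' = 0"
  shows "I_A2 (Suc m) \<mu> = real (Suc m) / (fact m)\<^sup>2 * inj_prod_sum m B (\<lambda>b. covariance_form \<mu> b b)"
proof -
  interpret prob_space \<mu> using \<mu> by (rule sphere_probsD)
  define c where "c = (\<integral>x. x \<partial>\<mu>)"
  define F where "F = {f \<in> {..<m} \<rightarrow>\<^sub>E B. inj_on f {..<m}}"
  \<comment> \<open>Index \<open>m\<close> carries the border column of ones; the shift by
    \<open>c\<close> cancels in differences of vertices.\<close>
  define h where "h f j x = (if j < m then (x - c) \<bullet> f j else 1)" for f :: "nat \<Rightarrow> 'a" and j :: nat and x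
  let ?D = "\<lambda>f x. (det_fun (Suc m) (\<lambda>i j. h f j (x i)))\<^sup>2"
  let ?P = "PiM {..<Suc m} (\<lambda>_. \<mu>)"
  have vol: "simplex_vol_sq (Suc m) x = (\<Sum>f\<in>F. ?D f x) / (fact m * (fact m)\<^sup>2)" for x :: "nat \<Rightarrow> 'a"
  proof -
    have "det_fun m (\<lambda>i j. (x i - x m) \<bullet> f j) = det_fun (Suc m) (\<lambda>i j. h f j (x i))" for f
      using det_fun_bordered[of m "\<lambda>i j. (x i - c) \<bullet> f j"]
      by (simp add: h_def inner_diff_left)
    then have "fact m * det_fun m (\<lambda>i j. (x i - x m) \<bullet> (x j - x m)) = (\<Sum>f\<in>F. ?D f x)"
      using det_fun_Gram[OF \<open>finite B\<close>, of m "\<lambda>i b. (x i - x m) \<bullet> b"]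
      by (simp add: F_def inner[symmetric])
    then show ?thesis by (simp add: simplex_vol_sq_def field_simps)
  qed
  have int: "integrable \<mu> (\<lambda>x. h f i x * h f j x)" for f i j
  proof (intro sphere_probs_integrable[OF \<mu>] continuous_on_mult)
    show "continuous_on UNIV (h f i)" for f i
      unfolding h_def by (cases "i < m") (auto intro!: continuous_intros)
    then show "continuous_on UNIV (h f j)" .
  qed
  have orth: "(\<integral>x. h f i x * h f j x \<partial>\<mu>) = 0" if "f \<in> F" "i < Suc m" "j < Suc m" "i \<noteq> j" for f i j
  proof -
    have "f i \<in> B" "f j \<in> B" "f i \<noteq> f j" if "i < m" "j < m"
      using that \<open>f \<in> F\<close> \<open>i \<noteq> j\<close> by (auto simp: F_def PiE_iff inj_on_def)
    then show ?thesis
      using that diag integral_centred_inner[OF \<mu>]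
      by (auto simp: h_def c_def covariance_form_def less_Suc_eq)
  qed
  have val: "integrable ?P (?D f)"
    "(\<integral>x. ?D f x \<partial>?P) = fact (Suc m) * (\<Prod>j<m. covariance_form \<mu> (f j) (f j))" if "f \<in> F" for f
  proof -
    show "integrable ?P (?D f)"
      by (rule integral_det_fun_orthogonal_sq(1)) (use int orth that prob_space_axioms in auto)
    have "(\<integral>x. ?D f x \<partial>?P) = fact (Suc m) * (\<Prod>j<Suc m. \<integral>x. (h f j x)\<^sup>2 \<partial>\<mu>)"
      by (rule integral_det_fun_orthogonal_sq(2)) (use int orth that prob_space_axioms in auto)
    also have "(\<Prod>j<Suc m. \<integral>x. (h f j x)\<^sup>2 \<partial>\<mu>) = (\<Prod>j<m. covariance_form \<mu> (f j) (f j))"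
      by (simp add: h_def covariance_form_def c_def power2_eq_square prob_space)
    finally show "(\<integral>x. ?D f x \<partial>?P) = fact (Suc m) * (\<Prod>j<m. covariance_form \<mu> (f j) (f j))" .
  qed
  have "I_A2 (Suc m) \<mu> = (\<Sum>f\<in>F. \<integral>x. ?D f x \<partial>?P) / (fact m * (fact m)\<^sup>2)"
    unfolding I_A2_def vol integral_divide_zero by (simp only: Bochner_Integration.integral_sum val(1))
  also have "\<dots> = fact (Suc m) * inj_prod_sum m B (\<lambda>b. covariance_form \<mu> b b) / (fact m * (fact m)\<^sup>2)"
    by (simp add: val(2) inj_prod_sum_def F_def sum_distrib_left del: fact_Suc)
  also have "\<dots> = real (Suc m) / (fact m)\<^sup>2 * inj_prod_sum m B (\<lambda>b. covariance_form \<mu> b b)"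
    by simp
  finally show ?thesis .
qed

text \<open>The covariance is \<open>1 / d\<close> times the identity, so the standard basis already
  diagonalises it and all eigenvalues agree.\<close>

lemma I_A2_balanced_isotropic:
  assumes \<mu>: "\<mu> \<in> (sphere_probs :: 'a::euclidean_space measure set)"
    and "balanced \<mu>" "isotropic \<mu>" "m \<le> DIM('a)"
  shows "I_A2 (Suc m) \<mu> = real (Suc m) / (fact m * real DIM('a) ^ m) * real (DIM('a) choose m)"
proof -
  have cov: "covariance_form \<mu> i j = (if i = j then 1 / real DIM('a) else 0)"
    if "i \<in> Basis" "j \<in> Basis" for i j
    using assms that by (simp add: covariance_form_eq[OF \<mu>] balanced_def isotropic_def)
  have "I_A2 (Suc m) \<mu> = real (Suc m) / (fact m)\<^sup>2 * inj_prod_sum m Basis (\<lambda>b. covariance_form \<mu> b b)"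
    using \<mu> by (intro I_A2_eq_inj_prod_sum euclidean_inner) (auto simp: cov)
  also have "inj_prod_sum m Basis (\<lambda>b. covariance_form \<mu> b b)
      = fact m * real (DIM('a) choose m) * (1 / real DIM('a)) ^ m"
    using assms by (intro inj_prod_sum_const) (auto simp: cov)
  finally show ?thesis by (simp add: power2_eq_square power_divide)
qed

text \<open>Two bounds are chained: Maclaurin for eigenvalue sum \<open>s\<close>, then
  \<open>s \<le> 1\<close>. Equality in the second forces mean zero; equality in the first then
  forces all eigenvalues to be \<open>1 / d\<close>, a conclusion that degree 1 would not
  give.\<close>

lemma I_A2_upper_bound:
  assumes \<mu>: "\<mu> \<in> (sphere_probs :: 'a::euclidean_space measure set)" and m: "2 \<le> m" "m \<le> DIM('a)"
  defines "M \<equiv> real (Suc m) / (fact m * real DIM('a) ^ m) * real (DIM('a) choose m)"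
  shows "I_A2 (Suc m) \<mu> \<le> M" and "I_A2 (Suc m) \<mu> = M \<Longrightarrow> balanced \<mu> \<and> isotropic \<mu>"
proof -
  let ?Q = "covariance_form \<mu>"
  interpret Q: bounded_bilinear ?Q using \<mu> by (rule bounded_bilinear_covariance_form)
  have sym: "?Q u v = ?Q v u" for u v by (simp add: covariance_form_def mult.commute)
  obtain B where B: "finite B" "card B = DIM('a)"
    and inner: "\<And>u v. u \<bullet> v = (\<Sum>b\<in>B. (u \<bullet> b) * (v \<bullet> b))"
    and expand: "\<And>x. x = (\<Sum>b\<in>B. (x \<bullet> b) *\<^sub>R b)"
    and diag: "\<And>b b'. b \<in> B \<Longrightarrow> b' \<in> B \<Longrightarrow> b \<noteq> b' \<Longrightarrow> ?Q b b' = 0"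
    by (rule diagonalising_orthonormal_basis[OF Q.bounded_bilinear_axioms sym]) blast
  define l where "l b = ?Q b b" for b
  define s where "s = sum l B"
  define K where "K = real (Suc m) / (fact m)\<^sup>2 * (fact m * real (DIM('a) choose m))"
  have "K > 0" using m by (simp add: K_def)
  have M: "M = K * (1 / DIM('a)) ^ m"
    by (simp add: M_def K_def power2_eq_square power_divide)
  have I: "I_A2 (Suc m) \<mu> = real (Suc m) / (fact m)\<^sup>2 * inj_prod_sum m B l"
    unfolding l_def using \<mu> B(1) inner diag by (intro I_A2_eq_inj_prod_sum)
  have l_nonneg: "l b \<ge> 0" for b
    by (simp add: l_def covariance_form_def)
  have s: "s = 1 - (norm (\<integral>x. x \<partial>\<mu>))\<^sup>2"
    unfolding s_def l_def using \<mu> inner by (rule trace_covariance_form)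
  have "s \<ge> 0" by (simp add: s_def sum_nonneg l_nonneg)
  have le: "I_A2 (Suc m) \<mu> \<le> K * (s / DIM('a)) ^ m"
    unfolding I K_def mult.assoc s_def B(2)[symmetric]
    using m B l_nonneg Maclaurin_inequality(1)[of B m l]
    by (intro mult_left_mono) (auto simp: mult.assoc)
  have s_le: "K * (s / DIM('a)) ^ m \<le> M"
    unfolding M using \<open>K > 0\<close> \<open>s \<ge> 0\<close> s
    by (intro mult_left_mono power_mono divide_right_mono) auto
  show "I_A2 (Suc m) \<mu> \<le> M" using le s_le by simp
  assume eq: "I_A2 (Suc m) \<mu> = M"
  have "s = 1"
  proof (rule ccontr)
    assume "s \<noteq> 1"
    then have "s < 1" using s by (simp add: order_less_le)
    then have "(s / DIM('a)) ^ m < (1 / DIM('a)) ^ m"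
      using \<open>s \<ge> 0\<close> m by (intro power_strict_mono divide_strict_right_mono) auto
    then show False using le eq \<open>K > 0\<close> by (simp add: M)
  qed
  then have c: "(\<integral>x. x \<partial>\<mu>) = 0" using s by simp
  have l_eq: "l b = 1 / DIM('a)" if "b \<in> B" for b
  proof (rule ccontr)
    assume "l b \<noteq> 1 / DIM('a)"
    then have "inj_prod_sum m B l < fact m * real (DIM('a) choose m) * (1 / DIM('a)) ^ m"
      using Maclaurin_inequality(2)[of B m l b] m B l_nonneg that \<open>s = 1\<close> by (simp add: s_def)
    then have "I_A2 (Suc m) \<mu> < M"
      unfolding I M K_def mult.assoc by (intro mult_strict_left_mono) (auto simp: mult.assoc)
    then show False using eq by simp
  qed
  \<comment> \<open>Equal eigenvalues on \<open>B\<close> make the form a multiple of the inner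
    product, which can then be evaluated on \<open>Basis\<close>.\<close>
  have "?Q u v = (u \<bullet> v) / DIM('a)" for u v
  proof -
    have "?Q u v = ?Q (\<Sum>b\<in>B. (u \<bullet> b) *\<^sub>R b) (\<Sum>b\<in>B. (v \<bullet> b) *\<^sub>R b)"
      by (simp flip: expand)
    also have "\<dots> = (\<Sum>b'\<in>B. \<Sum>b\<in>B. (v \<bullet> b') * ((u \<bullet> b) * ?Q b b'))"
      by (simp add: Q.sum_left Q.sum_right Q.scaleR_left Q.scaleR_right sum_distrib_left)
    also have "\<dots> = (\<Sum>b'\<in>B. \<Sum>b\<in>B. if b = b' then (u \<bullet> b) * ((v \<bullet> b) / DIM('a)) else 0)"
      by (intro sum.cong refl) (auto simp: diag l_eq[unfolded l_def])
    also have "\<dots> = (\<Sum>b\<in>B. (u \<bullet> b) * (v \<bullet> b)) / DIM('a)"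
      using B(1) by (simp add: sum_divide_distrib)
    finally show ?thesis by (simp flip: inner)
  qed
  then show "balanced \<mu> \<and> isotropic \<mu>"
    using c by (auto simp: balanced_def isotropic_def covariance_form_def inner_Basis)
qed

section \<open>The maximizers and the maximum\<close>

theorem theorem7p1:
  fixes k :: nat
  assumes "DIM('a::euclidean_space) \<ge> 2" and "3 \<le> k" and "k \<le> DIM('a) + 1"
  shows "{\<mu> \<in> (sphere_probs :: 'a measure set). \<forall>\<nu>\<in>(sphere_probs :: 'a measure set). I_A2 k \<nu> \<le> I_A2 k \<mu>}
           = {\<mu> \<in> sphere_probs. balanced \<mu> \<and> isotropic \<mu>}
       \<and> (sphere_sigma :: 'a measure) \<in> sphere_probs
       \<and> (\<forall>\<nu>\<in>(sphere_probs :: 'a measure set). I_A2 k \<nu> \<le> I_A2 k (sphere_sigma :: 'a measure))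
       \<and> (\<forall>\<mu>\<in>(sphere_probs :: 'a measure set). balanced \<mu> \<and> isotropic \<mu> \<longrightarrow>
            I_A2 k \<mu> = real k / (fact (k - 1) * real DIM('a) ^ (k - 1)) * real (DIM('a) choose (k - 1)))"
proof -
  define M where "M = real k / (fact (k - 1) * real DIM('a) ^ (k - 1)) * real (DIM('a) choose (k - 1))"
  have k: "k = Suc (k - 1)" "2 \<le> k - 1" "k - 1 \<le> DIM('a)" using assms by auto
  have val: "I_A2 k \<mu> = M" if "\<mu> \<in> sphere_probs" "balanced \<mu>" "isotropic \<mu>" for \<mu> :: "'a measure"
    using I_A2_balanced_isotropic[OF that k(3)] k(1) by (simp add: M_def)
  have bound: "I_A2 k \<mu> \<le> M" "I_A2 k \<mu> = M \<Longrightarrow> balanced \<mu> \<and> isotropic \<mu>"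
    if "\<mu> \<in> sphere_probs" for \<mu> :: "'a measure"
    using I_A2_upper_bound[OF that k(2,3)] k(1) by (simp_all add: M_def)
  \<comment> \<open>This shows that the bound \<open>M\<close> is attained, so every maximizer has
    value \<open>M\<close> and falls under the equality case.\<close>
  have sigma: "I_A2 k (sphere_sigma :: 'a measure) = M"
    by (intro val sphere_sigma_in_sphere_probs balanced_sphere_sigma isotropic_sphere_sigma)
  have "balanced \<mu> \<and> isotropic \<mu>"
    if "\<mu> \<in> sphere_probs" "\<forall>\<nu>\<in>(sphere_probs :: 'a measure set). I_A2 k \<nu> \<le> I_A2 k \<mu>" for \<mu> :: "'a measure"
  proof (rule bound(2)[OF that(1)])
    show "I_A2 k \<mu> = M"
      using that sigma bound(1)[OF that(1)] sphere_sigma_in_sphere_probs by (metis order_antisym)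
  qed
  then show ?thesis
    using val bound(1) sigma sphere_sigma_in_sphere_probs unfolding M_def[symmetric] by auto
qed

end
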